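(* Let $\alpha:[0,+\infty)\to[1,+\infty)$ and $\beta:[0,+\infty)\to[0,1)$ be functions such that: (1) the product $\alpha(\cdot)\beta(\cdot)$ has the property $(MT)$; and (2) $\alpha$ is nonincreasing. Then every $(\alpha,\beta)$-contraction $F$ of a complete metric space $(X,d)$ into itself has a fixed point (i.e. a point $x_*\in X$ with $x_*\in F(x_* )$), whenever the distance function $d_F$ is stably positive.
   Context: A closed-valued mapping $F$ of a metric space $(X,d)$ into itself assigns to each $x\in X$ a nonempty closed subset $F(x)\subset X$. Its distance function is $d_F(x)=\mathrm{dist}(x,F(x))=\inf\{d(x,y): y\in F(x)\}$. Given $\alpha:[0,+\infty)\to[1,+\infty)$ and $\beta:[0,+\infty)\to[0,1)$, a closed-valued mapping $F$ of $(X,d)$ into itself is an $(\alpha,\beta)$-mapping if for each $x\in X$ there exists $y\in F(x)$ such that (A) $d(x,y)\le\alpha(d(x,y))\cdot d_F(x)$ and (B) $d_F(y)\le\beta(d(x,y))\cdot d(x,y)$. If, in addition, $\alpha(t)\beta(t)<1$ for all $t>0$, then $F$ is an $(\alpha,\beta)$-contraction. A function $k$ on $[0,\infty)$ has the property $(MT)$ if $\limsup_{s\to t+0}k(s)<1$ for every $t\ge 0$ (the limit superior as $s\to t$ with $s>t$). A nonnegative, not identically zero function $h:X\to[0,\infty)$ is stably positive if, for every $x\in X$, $h(x)>0$ implies that $\inf\{h(y): y\in O(x)\}>0$ for some neighborhood $O(x)$ of $x$. *)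

theory Defs
  imports "HOL-Analysis.Analysis"
begin

definition closed_valued :: "('a::metric_space \<Rightarrow> 'a set) \<Rightarrow> bool" where
  "closed_valued F \<longleftrightarrow> (\<forall>x. F x \<noteq> {} \<and> closed (F x))"

definition dist_fun :: "('a::metric_space \<Rightarrow> 'a set) \<Rightarrow> 'a \<Rightarrow> real" where
  "dist_fun F x = infdist x (F x)"

text \<open>Functions on the half-line of nonnegative reals are total functions on the reals of which
  only the values at nonnegative arguments are ever constrained or used.\<close>

definition alpha_beta_mapping ::
  "(real \<Rightarrow> real) \<Rightarrow> (real \<Rightarrow> real) \<Rightarrow> ('a::metric_space \<Rightarrow> 'a set) \<Rightarrow> bool" where
  "alpha_beta_mapping \<alpha> \<beta> F \<longleftrightarrow>
     closed_valued F \<and>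
     (\<forall>x. \<exists>y\<in>F x. dist x y \<le> \<alpha> (dist x y) * dist_fun F x \<and>
                    dist_fun F y \<le> \<beta> (dist x y) * dist x y)"

definition alpha_beta_contraction ::
  "(real \<Rightarrow> real) \<Rightarrow> (real \<Rightarrow> real) \<Rightarrow> ('a::metric_space \<Rightarrow> 'a set) \<Rightarrow> bool" where
  "alpha_beta_contraction \<alpha> \<beta> F \<longleftrightarrow>
     alpha_beta_mapping \<alpha> \<beta> F \<and> (\<forall>t>0. \<alpha> t * \<beta> t < 1)"

text \<open>The one-sided limit superior is taken in the extended reals, so that it always exists.\<close>

definition MT_property :: "(real \<Rightarrow> real) \<Rightarrow> bool" where
  "MT_property k \<longleftrightarrow> (\<forall>t\<ge>0. Limsup (at_right t) (\<lambda>s. ereal (k s)) < 1)"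

definition stably_positive :: "('a::topological_space \<Rightarrow> real) \<Rightarrow> bool" where
  "stably_positive h \<longleftrightarrow>
     (\<forall>x. h x \<ge> 0) \<and> (\<exists>x. h x \<noteq> 0) \<and>
     (\<forall>x. h x > 0 \<longrightarrow> (\<exists>U. open U \<and> x \<in> U \<and> (INF y\<in>U. h y) > 0))"

end

theory Submission
  imports Defs
begin

text \<open>
  Suppose \<open>F\<close> has no fixed point. As the values of \<open>F\<close> are closed, the distance function
  \<open>d\<^sub>F\<close> is then positive everywhere. Iterating the choice in the definition of an
  \<open>(\<alpha>, \<beta>)\<close>-mapping gives an orbit \<open>x\<^sub>0, x\<^sub>1, \<dots>\<close> whose steps
  \<open>t\<^sub>n = d(x\<^sub>n, x\<^sub>n\<^sub>+\<^sub>1)\<close> satisfy \<open>t\<^sub>n \<le> \<alpha>(t\<^sub>n) d\<^sub>F(x\<^sub>n)\<close> and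
  \<open>d\<^sub>F(x\<^sub>n\<^sub>+\<^sub>1) \<le> \<beta>(t\<^sub>n) t\<^sub>n\<close>. Two inequalities follow:

  \<^item> \<open>t\<^sub>n\<^sub>+\<^sub>1 \<le> \<alpha>(t\<^sub>n\<^sub>+\<^sub>1) \<beta>(t\<^sub>n) t\<^sub>n\<close>. If \<open>t\<^sub>n\<^sub>+\<^sub>1 \<ge> t\<^sub>n\<close>, monotonicity of \<open>\<alpha>\<close> would replace
    \<open>\<alpha>(t\<^sub>n\<^sub>+\<^sub>1)\<close> by \<open>\<alpha>(t\<^sub>n)\<close>, and \<open>\<alpha>\<beta> < 1\<close> would give \<open>t\<^sub>n\<^sub>+\<^sub>1 < t\<^sub>n\<close>. So the steps strictly decrease.
  \<^item> \<open>d\<^sub>F(x\<^sub>n\<^sub>+\<^sub>1) \<le> \<alpha>(t\<^sub>n) \<beta>(t\<^sub>n) d\<^sub>F(x\<^sub>n)\<close>. The steps approach their limit strictly from above, so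
    by the property (MT) at that limit the factor is eventually below some \<open>q < 1\<close>
    (lemma \<open>MT_property_eventually_less\<close>). Hence \<open>d\<^sub>F(x\<^sub>n)\<close> decays geometrically.

  Since \<open>\<alpha>\<close> is nonincreasing, it is bounded by \<open>\<alpha>(0)\<close>, so \<open>t\<^sub>n \<le> \<alpha>(0) d\<^sub>F(x\<^sub>n)\<close> decays
  geometrically too and the orbit converges (lemma \<open>Cauchy_if_dist_summable\<close>). At its limit
  \<open>d\<^sub>F\<close> need not be continuous, but stable positivity is exactly what forces it to vanish there
  (lemma \<open>stably_positive_limit_zero\<close>): a contradiction.
\<close>

text \<open>A stably positive function is bounded away from zero near each point where it is
  positive, so a sequence along which it tends to zero cannot converge to such a point.\<close>

lemma stably_positive_limit_zero:
  assumes h: "stably_positive h" and x: "X \<longlonglongrightarrow> x" and hX: "(\<lambda>n. h (X n)) \<longlonglongrightarrow> 0"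
  shows "h x = 0"
proof (rule ccontr)
  assume "h x \<noteq> 0"
  with h have "h x > 0"
    by (auto simp: stably_positive_def less_le)
  with h obtain U where U: "open U" "x \<in> U" and pos: "(INF y\<in>U. h y) > 0"
    by (auto simp: stably_positive_def)
  have "bdd_below (h ` U)"
    using h by (auto simp: stably_positive_def intro!: bdd_belowI[of _ 0])
  then have low: "(INF y\<in>U. h y) \<le> h y" if "y \<in> U" for y
    using that by (rule cINF_lower)
  have "eventually (\<lambda>n. X n \<in> U) sequentially"
    using x U by (rule topological_tendstoD)
  moreover have "eventually (\<lambda>n. h (X n) < (INF y\<in>U. h y)) sequentially"
    using hX pos by (rule order_tendstoD)
  ultimately have "eventually (\<lambda>n. False) sequentially"
    by eventually_elim (use low in force)
  then show False
    by simp
qed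

text \<open>The limit superior in the property (MT) is one-sided, which suffices because a strictly
  decreasing sequence never reaches its limit.\<close>

lemma MT_property_eventually_less:
  fixes t :: "nat \<Rightarrow> real"
  assumes k: "MT_property k" and nonneg: "\<And>n. t n \<ge> 0" and decr: "\<And>n. t (Suc n) < t n"
  obtains q where "q < 1" and "eventually (\<lambda>n. k (t n) < q) sequentially"
proof -
  have dec: "decseq t"
    using decr by (simp add: decseq_Suc_iff less_imp_le)
  obtain L where L: "t \<longlonglongrightarrow> L" and L_le: "\<And>n. L \<le> t n"
    using decseq_convergent[OF dec, of 0] nonneg by blast
  have above: "L < t n" for n
    using L_le[of "Suc n"] decr[of n] by simp
  have "L \<ge> 0"
    using LIMSEQ_le_const[OF L] nonneg by blast
  with k have "Limsup (at_right L) (\<lambda>s. ereal (k s)) < 1"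
    by (simp add: MT_property_def)
  then obtain q where q: "Limsup (at_right L) (\<lambda>s. ereal (k s)) < ereal q" "ereal q < 1"
    using ereal_dense2 by blast
  have "eventually (\<lambda>s. k s < q) (at_right L)"
    using Limsup_lessD[OF q(1)] by simp
  moreover have "filterlim t (at_right L) sequentially"
    using L above by (auto simp: filterlim_at intro!: always_eventually less_imp_neq[THEN not_sym])
  ultimately have "eventually (\<lambda>n. k (t n) < q) sequentially"
    by (rule eventually_compose_filterlim)
  with q(2) show thesis
    by (intro that) auto
qed

lemma Cauchy_if_dist_summable:
  fixes X :: "nat \<Rightarrow> 'a::metric_space"
  assumes "summable (\<lambda>n. dist (X n) (X (Suc n)))"
  shows "Cauchy X"
proof -
  have tri: "dist (X m) (X n) \<le> (\<Sum>i=m..<n. dist (X i) (X (Suc i)))" if "m \<le> n" for m n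
    using that
  proof (induction n rule: dec_induct)
    case (step n)
    then show ?case
      using dist_triangle[of "X m" "X (Suc n)" "X n"] by simp
  qed simp
  show ?thesis
    unfolding Cauchy_altdef2
  proof (intro allI impI)
    fix e :: real
    assume "e > 0"
    then obtain N where N: "\<And>m n. m \<ge> N \<Longrightarrow> norm (\<Sum>i=m..<n. dist (X i) (X (Suc i))) < e"
      using assms unfolding summable_Cauchy by blast
    have "dist (X n) (X N) < e" if "n \<ge> N" for n
      using tri[OF that] N[of N n] by (simp add: dist_commute)
    then show "\<exists>N. \<forall>n\<ge>N. dist (X n) (X N) < e"
      by blast
  qed
qed

theorem theorem1p5:
  fixes \<alpha> \<beta> :: "real \<Rightarrow> real"
    and F :: "'a::complete_space \<Rightarrow> 'a set"
  assumes "\<And>t. t \<ge> 0 \<Longrightarrow> \<alpha> t \<ge> 1"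
    and "\<And>t. t \<ge> 0 \<Longrightarrow> 0 \<le> \<beta> t \<and> \<beta> t < 1"
    and "MT_property (\<lambda>t. \<alpha> t * \<beta> t)"
    and "antimono_on {0..} \<alpha>"
    and "alpha_beta_contraction \<alpha> \<beta> F"
    and "stably_positive (dist_fun F)"
  shows "\<exists>x. x \<in> F x"
proof (rule ccontr)
  assume no_fix: "\<nexists>x. x \<in> F x"
  have closed: "closed_valued F"
    and prod_less: "\<And>t. t > 0 \<Longrightarrow> \<alpha> t * \<beta> t < 1"
    and choice: "\<forall>x. \<exists>y. y \<in> F x \<and> dist x y \<le> \<alpha> (dist x y) * dist_fun F x \<and>
      dist_fun F y \<le> \<beta> (dist x y) * dist x y"
    using assms(5) by (auto simp: alpha_beta_contraction_def alpha_beta_mapping_def Bex_def)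
  have antimono: "\<alpha> t \<le> \<alpha> s" if "0 \<le> s" "s \<le> t" for s t
    using monotone_onD[OF assms(4), of s t] that by simp
  have pos: "dist_fun F x > 0" for x
    using infdist_pos_not_in_closed[of "F x" x] closed no_fix
    by (auto simp: closed_valued_def dist_fun_def)
  from choice obtain f where f: "\<And>x. f x \<in> F x"
    and fA: "\<And>x. dist x (f x) \<le> \<alpha> (dist x (f x)) * dist_fun F x"
    and fB: "\<And>x. dist_fun F (f x) \<le> \<beta> (dist x (f x)) * dist x (f x)"
    by metis
  \<comment> \<open>The orbit may start at any point; \<open>undefined\<close> is an arbitrary one.\<close>
  define X where "X n = (f ^^ n) undefined" for n
  define t where "t n = dist (X n) (X (Suc n))" for n
  define d where "d n = dist_fun F (X n)" for n
  have X_Suc: "X (Suc n) = f (X n)" for n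
    by (simp add: X_def)
  have A: "t n \<le> \<alpha> (t n) * d n" and B: "d (Suc n) \<le> \<beta> (t n) * t n" for n
    using fA[of "X n"] fB[of "X n"] by (simp_all add: t_def d_def X_Suc)
  have d_pos: "d n > 0" for n
    by (simp add: d_def pos)
  have t_pos: "t n > 0" for n
    using f[of "X n"] no_fix by (metis t_def X_Suc zero_less_dist_iff)
  have t_decr: "t (Suc n) < t n" for n
  proof (rule ccontr)
    assume "\<not> t (Suc n) < t n"
    then have "\<alpha> (t (Suc n)) \<le> \<alpha> (t n)"
      using antimono t_pos[of n] by simp
    then have "\<alpha> (t (Suc n)) * d (Suc n) \<le> \<alpha> (t n) * (\<beta> (t n) * t n)"
      using B[of n] d_pos[of "Suc n"] assms(1)[of "t n"] t_pos[of n] by (intro mult_mono) auto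
    also have "\<dots> < t n"
      using prod_less[OF t_pos[of n]] t_pos[of n] by (simp flip: mult.assoc)
    finally show False
      using A[of "Suc n"] \<open>\<not> t (Suc n) < t n\<close> by simp
  qed
  have d_step: "d (Suc n) \<le> (\<alpha> (t n) * \<beta> (t n)) * d n" for n
    using B[of n] mult_left_mono[OF A[of n], of "\<beta> (t n)"] assms(2)[of "t n"] t_pos[of n]
    by (simp add: mult_ac)
  obtain q where "q < 1" and "eventually (\<lambda>n. \<alpha> (t n) * \<beta> (t n) < q) sequentially"
    using MT_property_eventually_less[OF assms(3), of t] less_imp_le[OF t_pos] t_decr by blast
  then obtain N where N: "\<And>n. n \<ge> N \<Longrightarrow> \<alpha> (t n) * \<beta> (t n) < q"
    by (auto simp: eventually_sequentially)
  have "norm (d (Suc n)) \<le> q * norm (d n)" if "n \<ge> N" for n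
  proof -
    have "(\<alpha> (t n) * \<beta> (t n)) * d n \<le> q * d n"
      using N[OF that] d_pos[of n] by (intro mult_right_mono) auto
    then show ?thesis
      using order_trans[OF d_step] d_pos[of n] d_pos[of "Suc n"] by (simp del: mult_le_cancel_right_pos)
  qed
  with \<open>q < 1\<close> have d_sum: "summable d"
    by (rule summable_ratio_test)
  have "norm (t n) \<le> \<alpha> 0 * d n" for n
  proof -
    have "\<alpha> (t n) * d n \<le> \<alpha> 0 * d n"
      using antimono[of 0 "t n"] t_pos[of n] d_pos[of n] by (intro mult_right_mono) auto
    then show ?thesis
      using A[of n] t_pos[of n] by simp
  qed
  then have "summable t"
    by (intro summable_comparison_test'[OF summable_mult[OF d_sum], of 0])
  then have "Cauchy X"
    by (intro Cauchy_if_dist_summable) (simp add: t_def[abs_def])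
  then obtain x where "X \<longlonglongrightarrow> x"
    by (auto simp: Cauchy_convergent_iff convergent_def)
  moreover have "(\<lambda>n. dist_fun F (X n)) \<longlonglongrightarrow> 0"
    using summable_LIMSEQ_zero[OF d_sum] by (simp add: d_def[abs_def])
  ultimately have "dist_fun F x = 0"
    by (rule stably_positive_limit_zero[OF assms(6)])
  with pos[of x] show False
    by simp
qed

end
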